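(* Let $d\ge1$. Let $D_0,D$ be open convex bounded domains in $\mathbb{R}^d$ with $D_0\cap\mathbb{Z}^d\neq\emptyset$ and $D\cap\mathbb{Z}^d\ne\emptyset$, and let $f_0,f:\mathbb{Z}^d\to\mathbb{C}$ satisfy $\operatorname{supp}f_0\subset D_0$, $\operatorname{supp}f\subset D$, and $f_0\not\equiv0$. Then $$\mathcal{F}f(p)=\big(\overline{\mathcal{F}f_0(p)}\big)^{-1}\mathcal{F}q(p),\qquad p\in T^d,\ \mathcal{F}f_0(p)\ne0,$$ where $$q(x)=\chi_{D-D_0}(x)\Big(u(x)-(2\pi)^{-d/2}\sum_{y\in D_0\cap\mathbb{Z}^d}f_0(x+y)\overline{f_0(y)}\Big),\qquad x\in\mathbb{Z}^d,$$ and where $u:\mathbb{Z}^d\to\mathbb{C}$ can be taken as follows: (i) if $\operatorname{dist}(D,D_0)>\operatorname{diam}D$, then $u(x)=\mathcal{F}^{-1}\big(|\mathcal{F}(f+f_0)|^2\big)(x)$, $x\in\mathbb{Z}^d$; (ii) if $\operatorname{dist}(D,D_0)>0$, then $u(x)=\mathcal{F}^{-1}\big(|\mathcal{F}(f+f_0)|^2\big)(x)-\mathcal{F}^{-1}\big(|\mathcal{F}f|^2\big)(x)$, $x\in\mathbb{Z}^d$. That is, the formula for $\mathcal{F}f$ holds with $u$ as in (i) under the hypothesis of (i), and with $u$ as in (ii) under the hypothesis of (ii).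
   Context: $T^d=\mathbb{R}^d/2\pi\mathbb{Z}^d$. Discrete Fourier transform: $\mathcal{F}u(k)=(2\pi)^{-d/2}\sum_{x\in\mathbb{Z}^d}u(x)e^{-ik\cdot x}$, $k\in T^d$, with inverse $\mathcal{F}^{-1}w(x)=(2\pi)^{-d/2}\int_{T^d}w(k)e^{ik\cdot x}\,dk$, $x\in\mathbb{Z}^d$. For bounded sets in $\mathbb{R}^d$: $\operatorname{diam}D=\sup_{x,y\in D}|x-y|$, $\operatorname{dist}(D,D_0)=\inf_{x\in D,\,y\in D_0}|x-y|$, $D-D_0=\{x-y:\ x\in D,\ y\in D_0\}$; $\chi_{D-D_0}$ is the characteristic function of $D-D_0$. The zero set $\{p\in T^d:\mathcal{F}f_0(p)=0\}$ has measure zero, so the formula for $\mathcal{F}f(p)$ is defined for almost every $p\in T^d$. *)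

theory Defs
  imports "HOL-Analysis.Analysis"
begin

text \<open>
  The lattice \<open>\<int>\<^sup>d\<close> is the type \<open>int ^ 'n\<close> with \<open>d = CARD('n)\<close>.  Functions on the torus
  \<open>\<real>\<^sup>d / 2\<pi>\<int>\<^sup>d\<close> are represented by \<open>2\<pi>\<close>-periodic functions on \<open>real ^ 'n\<close>, and integrals over
  the torus are integrals over the fundamental cell \<open>[0, 2\<pi>]\<^sup>d\<close>.
\<close>

definition lat :: "int ^ 'n \<Rightarrow> real ^ 'n" where
  "lat x = (\<chi> i. of_int (x $ i))"

definition dft :: "(int ^ 'n \<Rightarrow> complex) \<Rightarrow> real ^ 'n \<Rightarrow> complex" where
  "dft u k = of_real ((2 * pi) powr (- real CARD('n) / 2)) *
     (\<Sum>\<^sub>\<infinity>x\<in>UNIV. u x * exp (- (\<i> * of_real (k \<bullet> lat x))))"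

definition inv_dft :: "(real ^ 'n \<Rightarrow> complex) \<Rightarrow> int ^ 'n \<Rightarrow> complex" where
  "inv_dft w x = of_real ((2 * pi) powr (- real CARD('n) / 2)) *
     (LINT k:cbox 0 (\<chi> i. 2 * pi)|lborel. w k * exp (\<i> * of_real (k \<bullet> lat x)))"

definition set_diff_minkowski :: "(real ^ 'n) set \<Rightarrow> (real ^ 'n) set \<Rightarrow> (real ^ 'n) set" where
  "set_diff_minkowski D D0 = {x - y | x y. x \<in> D \<and> y \<in> D0}"

definition recon_q ::
  "(real ^ 'n) set \<Rightarrow> (real ^ 'n) set \<Rightarrow> (int ^ 'n \<Rightarrow> complex) \<Rightarrow> (int ^ 'n \<Rightarrow> complex)
    \<Rightarrow> int ^ 'n \<Rightarrow> complex" where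
  "recon_q D0 D f0 u x = indicator (set_diff_minkowski D D0) (lat x) *
     (u x - of_real ((2 * pi) powr (- real CARD('n) / 2)) *
        (\<Sum>y | lat y \<in> D0. f0 (x + y) * cnj (f0 y)))"

text \<open>
  The transform is well defined on the torus, so quantifying over \<open>p\<close> in the torus amounts to
  quantifying over all \<open>p :: real ^ 'n\<close>.
\<close>

lemma dft_periodic: "dft u (k + (2 * pi) *\<^sub>R lat m) = dft u k"
proof -
  have "exp (- (\<i> * of_real ((k + (2 * pi) *\<^sub>R lat m) \<bullet> lat x)))
      = exp (- (\<i> * of_real (k \<bullet> lat x)))" for x
  proof -
    define N where "N = (\<Sum>i\<in>UNIV. m $ i * x $ i)"
    have "lat m \<bullet> lat x = of_int N"
      by (simp add: N_def lat_def inner_vec_def)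
    then have "- (\<i> * of_real ((k + (2 * pi) *\<^sub>R lat m) \<bullet> lat x))
        = - (\<i> * of_real (k \<bullet> lat x)) + (of_int (2 * (- N)) * pi) * \<i>"
      by (simp add: inner_add_left algebra_simps)
    then show ?thesis
      unfolding exp_eq by blast
  qed
  then show ?thesis
    by (simp add: dft_def)
qed

end

theory Submission
  imports Defs
begin

text \<open>
  The squared modulus of a Fourier transform carries no phase, but its inverse transform is a
  correlation, and correlations of objects in different places have different supports.  With
  \<open>c = (2\<pi>)\<^sup>-\<^sup>d\<^sup>/\<^sup>2\<close> and \<open>g \<star> h = (\<lambda>x. \<Sum>y. g (x + y) * cnj (h y))\<close>, the characters of the torus
  being orthogonal gives \<open>inv_dft \<bar>dft g\<bar>\<^sup>2 = c (g \<star> g)\<close> (\<open>inv_dft_power_spectrum\<close>).  For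
  \<open>g = f + f0\<close> the right-hand side splits into the four terms
  \<open>c (f \<star> f + f \<star> f0 + f0 \<star> f + f0 \<star> f0)\<close>.

  The term \<open>f \<star> f0\<close> contains \<open>f\<close> with its phase, since \<open>dft (c (f \<star> f0)) = dft f * cnj (dft f0)\<close>
  (\<open>dft_cross_corr\<close>), and it lives on \<open>D - D0\<close>.  The known term \<open>f0 \<star> f0\<close> is subtracted in
  \<open>recon_q\<close>, and the indicator of \<open>D - D0\<close> removes the others.  The mirror term \<open>f0 \<star> f\<close> lives on
  \<open>D0 - D\<close>, which misses \<open>D - D0\<close> as soon as the convex sets \<open>D\<close> and \<open>D0\<close> are disjoint
  (\<open>disjoint_minkowski_differences\<close>).  The term \<open>f \<star> f\<close> lives on \<open>D - D\<close>, whose vectors are no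
  longer than the diameter of \<open>D\<close>; in the first case these are too short to lie in \<open>D - D0\<close>
  (\<open>minkowski_difference_disjoint_self\<close>), and in the second case the term is subtracted in \<open>u\<close>.
  Hence \<open>recon_q\<close> equals \<open>c (f \<star> f0)\<close>, and dividing its transform by \<open>cnj (dft f0)\<close> yields
  \<open>dft f\<close>.
\<close>

section \<open>Finitely supported lattice functions\<close>

lemma inj_lat: "inj lat"
  by (auto simp: inj_def lat_def vec_eq_iff)

lemma lat_add: "lat (x + y) = lat x + lat y"
  by (simp add: lat_def vec_eq_iff)

lemma lat_diff: "lat (x - y) = lat x - lat y"
  by (simp add: lat_def vec_eq_iff)

lemma finite_lattice_points:
  fixes D :: "(real ^ 'n) set"
  assumes "bounded D"
  shows "finite {x. lat x \<in> D}"
proof -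
  obtain B where B: "\<And>v. v \<in> D \<Longrightarrow> norm v \<le> B"
    using assms by (auto simp: bounded_iff)
  define N where "N = \<lceil>B\<rceil>"
  have "x $ i \<in> {- N..N}" if "lat x \<in> D" for x :: "int ^ 'n" and i
  proof -
    have "\<bar>of_int (x $ i)\<bar> \<le> B"
      using component_le_norm_cart[of "lat x" i] B[OF that] by (simp add: lat_def)
    then show ?thesis
      unfolding N_def atLeastAtMost_iff by linarith
  qed
  then have "vec_nth ` {x. lat x \<in> D} \<subseteq> PiE UNIV (\<lambda>_::'n. {- N..N})"
    by auto
  then have "finite (vec_nth ` {x. lat x \<in> D})"
    by (rule finite_subset) (simp add: finite_PiE)
  then show ?thesis
    by (rule finite_imageD) (auto simp: inj_on_def vec_eq_iff)
qed

lemma finite_lattice_support: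
  fixes D :: "(real ^ 'n) set"
  assumes "bounded D" and "lat ` {x. u x \<noteq> 0} \<subseteq> D"
  shows "finite {x. u x \<noteq> 0}"
  by (rule finite_subset[OF _ finite_lattice_points[OF assms(1)]]) (use assms(2) in auto)

definition dft_const :: "nat \<Rightarrow> real" where
  "dft_const d = (2 * pi) powr (- real d / 2)"

text \<open>
  Two of the three constants in \<open>inv_dft \<bar>dft g\<bar>\<^sup>2\<close> cancel against the volume of the torus, so one
  is left over.
\<close>

lemma dft_const_normalization: "dft_const d * dft_const d * (2 * pi) ^ d = 1"
proof -
  have "dft_const d * dft_const d * (2 * pi) ^ d
      = (2 * pi) powr (- real d / 2 + - real d / 2 + real d)"
    unfolding dft_const_def powr_add by (simp add: powr_realpow)
  also have "\<dots> = 1"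
    by simp
  finally show ?thesis .
qed

text \<open>
  The set \<open>S\<close> may be larger than the support: for a correlation a set containing the support is
  at hand, while the support itself depends on cancellations.
\<close>

lemma dft_eq_sum:
  fixes u :: "int ^ 'n \<Rightarrow> complex"
  assumes "finite S" and "\<And>x. x \<notin> S \<Longrightarrow> u x = 0"
  shows "dft u k = dft_const CARD('n) * (\<Sum>x\<in>S. u x * exp (- (\<i> * of_real (k \<bullet> lat x))))"
proof -
  have "(\<Sum>\<^sub>\<infinity>x\<in>UNIV. u x * exp (- (\<i> * of_real (k \<bullet> lat x))))
      = (\<Sum>\<^sub>\<infinity>x\<in>S. u x * exp (- (\<i> * of_real (k \<bullet> lat x))))"
    using assms(2) by (intro infsum_cong_neutral) auto
  then show ?thesis
    using assms(1) by (simp add: dft_def dft_const_def)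
qed

section \<open>Orthogonality of characters\<close>

lemma integral_character_circle:
  fixes r :: real
  assumes "r \<in> \<int>"
  shows "integrable lborel (\<lambda>t. indicator {0..2 * pi} t *\<^sub>R exp (\<i> * of_real (t * r)))" (is ?int)
    and "(LINT t|lborel. indicator {0..2 * pi} t *\<^sub>R exp (\<i> * of_real (t * r)))
          = (if r = 0 then 2 * pi else 0)" (is ?val)
proof -
  have cont: "continuous_on {0..2 * pi} (\<lambda>t. exp (\<i> * of_real (t * r)))"
    by (intro continuous_intros)
  show ?int
    using borel_integrable_compact[OF _ cont] by simp
  show ?val
  proof (cases "r = 0")
    case True
    then show ?thesis by (simp add: scaleR_conv_of_real)
  next
    case False
    define F where "F t = exp (\<i> * of_real (t * r)) / (\<i> * of_real r)" for t
    have "(LINT t|lborel. indicator {0..2 * pi} t *\<^sub>R exp (\<i> * of_real (t * r))) = F (2 * pi) - F 0"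
    proof (rule integral_FTC_Icc[OF _ _ cont])
      show "(F has_vector_derivative exp (\<i> * of_real (t * r))) (at t within {0..2 * pi})" for t
      proof -
        have "((\<lambda>w. exp (\<i> * (w * of_real r)) / (\<i> * of_real r)) has_field_derivative
            exp (\<i> * (of_real t * of_real r))) (at (of_real t))"
          using False by (auto intro!: derivative_eq_intros simp: mult_ac)
        from has_vector_derivative_real_field[OF this] show ?thesis
          by (simp add: F_def[abs_def])
      qed
    qed simp
    also have "F (2 * pi) = F 0"
    proof -
      obtain n where "r = of_int n"
        using assms by (auto elim: Ints_cases)
      then have "exp (\<i> * of_real (2 * pi * r)) = 1"
        unfolding exp_eq_1 by (auto intro!: exI[of _ n])
      then show ?thesis by (simp add: F_def)
    qed
    finally show ?thesis using False by simp
  qed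
qed

text \<open>
  The cell is a product of intervals and a character is a product of characters of the coordinates,
  so the integral factors over the coordinates; a nonzero \<open>x\<close> has a nonzero coordinate, and the
  factor belonging to it vanishes.
\<close>

lemma integral_character_torus:
  fixes x :: "int ^ 'n"
  shows "(LINT k:cbox 0 (\<chi> i. 2 * pi)|lborel. exp (\<i> * of_real (k \<bullet> lat x)))
    = (if x = 0 then (2 * pi) ^ CARD('n) else 0)"
proof -
  interpret product_sigma_finite "\<lambda>_ :: real ^ 'n. lborel :: real measure"
    by standard
  let ?e = "\<lambda>b t. indicator {0..2 * pi} t *\<^sub>R exp (\<i> * of_real (t * (lat x \<bullet> b)))"
  have Ints: "lat x \<bullet> b \<in> \<int>" if "b \<in> Basis" for b
    using that by (auto simp: Basis_vec_def inner_axis lat_def)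
  have edge: "(\<chi> i. 2 * pi) \<bullet> b = 2 * pi" if "b \<in> Basis" for b :: "real ^ 'n"
    using that by (auto simp: Basis_vec_def inner_axis)
  have fac: "indicator (cbox 0 (\<chi> i. 2 * pi)) k *\<^sub>R exp (\<i> * of_real (k \<bullet> lat x))
      = (\<Prod>b\<in>Basis. ?e b (k \<bullet> b))" for k :: "real ^ 'n"
  proof (cases "k \<in> cbox 0 (\<chi> i. 2 * pi)")
    case True
    then have "?e b (k \<bullet> b) = exp (\<i> * of_real ((k \<bullet> b) * (lat x \<bullet> b)))" if "b \<in> Basis" for b
      using that edge by (auto simp: mem_box)
    then show ?thesis
      using True
      by (simp add: euclidean_inner[of k "lat x"] sum_distrib_left exp_sum)
  next
    case False
    then obtain b where "b \<in> Basis" "k \<bullet> b \<notin> {0..2 * pi}"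
      using edge by (auto simp: mem_box)
    then have "(\<Prod>b\<in>Basis. ?e b (k \<bullet> b)) = 0"
      by (intro prod_zero) (auto intro!: bexI[of _ b])
    then show ?thesis
      using False by simp
  qed
  have "(LINT k:cbox 0 (\<chi> i. 2 * pi)|lborel. exp (\<i> * of_real (k \<bullet> lat x)))
      = (LINT k|lborel. (\<Prod>b\<in>Basis. ?e b (k \<bullet> b)))"
    unfolding set_lebesgue_integral_def fac ..
  also have "\<dots> = (LINT v|(\<Pi>\<^sub>M b\<in>Basis. lborel). (\<Prod>b\<in>Basis. ?e b (v b)))"
    by (subst lborel_eq, subst integral_distr) auto
  also have "\<dots> = (\<Prod>b\<in>Basis. (LINT t|lborel. ?e b t))"
    using integral_character_circle(1)[OF Ints] by (intro product_integral_prod) auto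
  also have "\<dots> = (\<Prod>b\<in>Basis. complex_of_real (if lat x \<bullet> b = 0 then 2 * pi else 0))"
    using integral_character_circle(2)[OF Ints] by (intro prod.cong) auto
  also have "\<dots> = (if x = 0 then (2 * pi) ^ CARD('n) else 0)"
  proof (cases "x = 0")
    case True
    then have "lat x = 0" by (simp add: lat_def vec_eq_iff)
    then show ?thesis using True by simp
  next
    case False
    then have "lat x \<noteq> lat 0"
      by (simp add: inj_eq[OF inj_lat])
    then have "lat x \<noteq> 0"
      by (simp add: lat_def vec_eq_iff)
    then obtain b where "b \<in> Basis" "lat x \<bullet> b \<noteq> 0"
      using euclidean_all_zero_iff[of "lat x"] by blast
    then have "(\<Prod>b\<in>Basis. complex_of_real (if lat x \<bullet> b = 0 then 2 * pi else 0)) = 0"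
      by (intro prod_zero) auto
    then show ?thesis using False by simp
  qed
  finally show ?thesis .
qed

section \<open>Cross-correlations\<close>

text \<open>
  Summing over the support of \<open>h\<close> makes this a sum with finitely many terms as soon as \<open>h\<close> has
  finite support, for arbitrary \<open>g\<close>.
\<close>

definition cross_corr :: "('a::ab_group_add \<Rightarrow> complex) \<Rightarrow> ('a \<Rightarrow> complex) \<Rightarrow> 'a \<Rightarrow> complex" where
  "cross_corr g h x = (\<Sum>y | h y \<noteq> 0. g (x + y) * cnj (h y))"

lemma cross_corr_eq_sum:
  assumes "finite S" and "\<And>y. y \<notin> S \<Longrightarrow> h y = 0"
  shows "cross_corr g h x = (\<Sum>y\<in>S. g (x + y) * cnj (h y))"
  unfolding cross_corr_def using assms by (intro sum.mono_neutral_left) auto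

lemma cross_corr_nonzeroE:
  assumes "cross_corr g h x \<noteq> 0"
  obtains y where "h y \<noteq> 0" and "g (x + y) \<noteq> 0"
proof -
  have "\<exists>y\<in>{y. h y \<noteq> 0}. g (x + y) * cnj (h y) \<noteq> 0"
    using assms unfolding cross_corr_def by (meson sum.neutral)
  then show ?thesis using that by auto
qed

text \<open>
  This is the interference pattern: the correlation of a superposition with itself consists of the
  two autocorrelations and the two cross terms, which are mirror images of each other up to
  conjugation.
\<close>

lemma cross_corr_add_self:
  assumes "finite {x. g x \<noteq> 0}" and "finite {x. h x \<noteq> 0}"
  shows "cross_corr (\<lambda>x. g x + h x) (\<lambda>x. g x + h x) x
    = cross_corr g g x + cross_corr g h x + cross_corr h g x + cross_corr h h x"
proof -
  define S where "S = {x. g x \<noteq> 0} \<union> {x. h x \<noteq> 0}"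
  have S: "finite S" "\<And>y. y \<notin> S \<Longrightarrow> g y = 0" "\<And>y. y \<notin> S \<Longrightarrow> h y = 0"
      "\<And>y. y \<notin> S \<Longrightarrow> g y + h y = 0"
    using assms by (auto simp: S_def)
  show ?thesis
    using S by (simp add: cross_corr_eq_sum[of S] algebra_simps sum.distrib)
qed

text \<open>
  Correlation is convolution with the conjugate reflection, so the transform turns it into a
  product with a conjugate; the proof substitutes \<open>z = x + y\<close> in the double sum.
\<close>

lemma dft_cross_corr:
  fixes g h :: "int ^ 'n \<Rightarrow> complex"
  assumes g: "finite {x. g x \<noteq> 0}" and h: "finite {x. h x \<noteq> 0}"
  shows "dft (\<lambda>x. dft_const CARD('n) * cross_corr g h x) k = dft g k * cnj (dft h k)"
proof -
  let ?G = "{x. g x \<noteq> 0}" and ?H = "{x. h x \<noteq> 0}"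
  let ?c = "of_real (dft_const CARD('n)) :: complex"
  let ?E = "\<lambda>x. exp (- (\<i> * of_real (k \<bullet> lat x)))"
  \<comment> \<open>Differences of points of the two supports: a finite set outside which the correlation
    vanishes.\<close>
  define S where "S = (\<lambda>(a, b). a - b) ` (?G \<times> ?H)"
  have fS: "finite S"
    using g h by (auto simp: S_def)
  have SI: "x \<in> S" if "g (x + y) \<noteq> 0" "h y \<noteq> 0" for x y
    unfolding S_def using that by (auto intro!: image_eqI[of _ _ "(x + y, y)"])
  have E: "?E (z - y) = ?E z * cnj (?E y)" for y z :: "int ^ 'n"
    by (simp add: exp_cnj lat_diff inner_diff_right flip: exp_add) (simp add: algebra_simps)
  have shift: "(\<Sum>x\<in>S. g (x + y) * ?E x) = (\<Sum>z\<in>?G. g z * ?E z) * cnj (?E y)" if "h y \<noteq> 0" for y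
  proof -
    have "(\<Sum>z\<in>?G. g z * ?E z) * cnj (?E y) = (\<Sum>z\<in>?G. g z * ?E (z - y))"
      unfolding E by (simp add: sum_distrib_right sum_distrib_left mult_ac)
    also have "\<dots> = (\<Sum>x\<in>(\<lambda>z. z - y) ` ?G. g (x + y) * ?E x)"
      by (subst sum.reindex) (auto simp: inj_on_def)
    also have "\<dots> = (\<Sum>x\<in>S. g (x + y) * ?E x)"
    proof (rule sum.mono_neutral_left[OF fS])
      show "(\<lambda>z. z - y) ` ?G \<subseteq> S"
        using that by (auto intro: SI[of _ y])
      have "x \<in> (\<lambda>z. z - y) ` ?G" if "g (x + y) \<noteq> 0" for x
        using that by (auto intro!: image_eqI[of _ _ "x + y"])
      then show "\<forall>x\<in>S - (\<lambda>z. z - y) ` ?G. g (x + y) * ?E x = 0"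
        by auto
    qed
    finally show ?thesis ..
  qed
  have "dft (\<lambda>x. ?c * cross_corr g h x) k = ?c * (\<Sum>x\<in>S. ?c * cross_corr g h x * ?E x)"
    using fS SI by (intro dft_eq_sum) (auto elim!: cross_corr_nonzeroE intro: ccontr)
  also have "\<dots> = ?c * ?c * (\<Sum>x\<in>S. \<Sum>y\<in>?H. cnj (h y) * (g (x + y) * ?E x))"
    by (simp add: cross_corr_def sum_distrib_left sum_distrib_right mult_ac)
  also have "(\<Sum>x\<in>S. \<Sum>y\<in>?H. cnj (h y) * (g (x + y) * ?E x))
      = (\<Sum>y\<in>?H. cnj (h y) * (\<Sum>x\<in>S. g (x + y) * ?E x))"
    by (subst sum.swap) (simp add: sum_distrib_left)
  also have "\<dots> = (\<Sum>y\<in>?H. cnj (h y) * ((\<Sum>z\<in>?G. g z * ?E z) * cnj (?E y)))"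
    using shift by (intro sum.cong) auto
  also have "\<dots> = (\<Sum>z\<in>?G. g z * ?E z) * cnj (\<Sum>y\<in>?H. h y * ?E y)"
    by (simp add: sum_distrib_left mult_ac del: exp_cnj)
  also have "?c * ?c * \<dots> = dft g k * cnj (dft h k)"
    using dft_eq_sum[OF g, of g k] dft_eq_sum[OF h, of h k] by simp
  finally show ?thesis .
qed

text \<open>
  Expanding the square gives a double sum of characters with frequencies \<open>y - x\<close>; by orthogonality,
  integration against the character of \<open>z\<close> keeps exactly the pairs with \<open>x = z + y\<close>.
\<close>

lemma inv_dft_power_spectrum:
  fixes g :: "int ^ 'n \<Rightarrow> complex"
  assumes g: "finite {x. g x \<noteq> 0}"
  shows "inv_dft (\<lambda>k. of_real ((cmod (dft g k))\<^sup>2)) z = dft_const CARD('n) * cross_corr g g z"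
proof -
  let ?G = "{x. g x \<noteq> 0}"
  let ?Q = "cbox 0 (\<chi> i. 2 * pi) :: (real ^ 'n) set"
  let ?c = "of_real (dft_const CARD('n)) :: complex"
  let ?e = "\<lambda>k x. exp (\<i> * of_real ((k :: real ^ 'n) \<bullet> lat x))"
  have int: "set_integrable lborel ?Q (\<lambda>k. ?e k x)" for x
    unfolding set_integrable_def
    by (intro borel_integrable_compact continuous_intros compact_cbox)
  have expand: "of_real ((cmod (dft g k))\<^sup>2) * ?e k z
      = (\<Sum>y\<in>?G. \<Sum>x\<in>?G. ?c * ?c * (g x * cnj (g y)) * ?e k (z + y - x))" for k
  proof -
    have e: "?e k (z + y - x) = exp (- (\<i> * of_real (k \<bullet> lat x))) * ?e k y * ?e k z" for x y
      by (simp add: lat_add lat_diff inner_add_right inner_diff_right algebra_simps flip: exp_add)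
    have "of_real ((cmod (dft g k))\<^sup>2) * ?e k z = dft g k * cnj (dft g k) * ?e k z"
      by (simp flip: complex_norm_square)
    also have "\<dots> = ?c * ?c * ((\<Sum>x\<in>?G. g x * exp (- (\<i> * of_real (k \<bullet> lat x))))
        * (\<Sum>y\<in>?G. cnj (g y) * ?e k y)) * ?e k z"
      using dft_eq_sum[OF g, of g k] by (simp add: exp_cnj)
    also have "\<dots> = (\<Sum>y\<in>?G. \<Sum>x\<in>?G. ?c * ?c * (g x * cnj (g y)) * ?e k (z + y - x))"
      unfolding e sum_product
      by (subst sum.swap) (simp add: sum_distrib_left sum_distrib_right mult_ac)
    finally show ?thesis .
  qed
  have "(LINT k:?Q|lborel. of_real ((cmod (dft g k))\<^sup>2) * ?e k z)
      = (\<Sum>y\<in>?G. \<Sum>x\<in>?G. ?c * ?c * (g x * cnj (g y)) * (LINT k:?Q|lborel. ?e k (z + y - x)))"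
    unfolding expand set_lebesgue_integral_def scaleR_sum_right mult_scaleR_right[symmetric]
    using g int[unfolded set_integrable_def]
    by (simp only: Bochner_Integration.integral_sum Bochner_Integration.integrable_sum
        integrable_mult_right integral_mult_right_zero simp_thms)
  also have "\<dots> = (\<Sum>y\<in>?G. \<Sum>x\<in>?G.
      if x = z + y then ?c * ?c * (g x * cnj (g y)) * (2 * pi) ^ CARD('n) else 0)"
    by (intro sum.cong refl) (auto simp: integral_character_torus)
  also have "\<dots> = (\<Sum>y\<in>?G. ?c * ?c * (2 * pi) ^ CARD('n) * (g (z + y) * cnj (g y)))"
    using g by (intro sum.cong) (auto simp: sum.delta' sum.delta)
  also have "\<dots> = ?c * ?c * (2 * pi) ^ CARD('n) * cross_corr g g z"
    by (simp add: cross_corr_def sum_distrib_left)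
  also have "?c * ?c * (2 * pi) ^ CARD('n) = 1"
    using arg_cong[OF dft_const_normalization[of "CARD('n)"], of "of_real :: real \<Rightarrow> complex"] by simp
  finally show ?thesis
    by (simp add: inv_dft_def dft_const_def)
qed

section \<open>Supports of the interference terms\<close>

text \<open>
  If \<open>a - b = b' - a'\<close>, then \<open>a + a' = b + b'\<close>, so the midpoint of \<open>a\<close> and \<open>a'\<close> is also the midpoint
  of \<open>b\<close> and \<open>b'\<close>; by convexity it is a common point of \<open>D\<close> and \<open>D0\<close>, contrary to their positive
  distance.
\<close>

lemma disjoint_minkowski_differences:
  fixes D D0 :: "(real ^ 'n) set"
  assumes "convex D" and "convex D0" and "setdist D D0 > 0"
  shows "set_diff_minkowski D D0 \<inter> set_diff_minkowski D0 D = {}"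
proof -
  have disj: False if "v \<in> D" "v \<in> D0" for v
    using setdist_eq_0I[OF that] assms(3) by simp
  have False if v: "a \<in> D" "b \<in> D0" "b' \<in> D0" "a' \<in> D" "a - b = b' - a'" for a b a' b'
  proof -
    have "(1/2) *\<^sub>R a + (1/2) *\<^sub>R a' \<in> D" "(1/2) *\<^sub>R b + (1/2) *\<^sub>R b' \<in> D0"
      using v assms(1,2) by (auto intro!: convexD)
    moreover have "a + a' = b + b'"
      using v(5) by (simp add: algebra_simps)
    then have "(1/2) *\<^sub>R a + (1/2) *\<^sub>R a' = (1/2) *\<^sub>R b + (1/2) *\<^sub>R b'"
      by (simp flip: scaleR_add_right)
    ultimately show False
      using disj by auto
  qed
  then show ?thesis
    by (auto simp: set_diff_minkowski_def)
qed

text \<open>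
  Vectors in \<open>D - D0\<close> are at least as long as the distance of \<open>D\<close> and \<open>D0\<close>, vectors in \<open>D - D\<close> at
  most as long as the diameter of \<open>D\<close>.
\<close>

lemma minkowski_difference_disjoint_self:
  fixes D D0 :: "(real ^ 'n) set"
  assumes "bounded D" and "setdist D D0 > diameter D"
  shows "set_diff_minkowski D D0 \<inter> set_diff_minkowski D D = {}"
proof -
  have False if v: "a \<in> D" "b \<in> D0" "c \<in> D" "c' \<in> D" "a - b = c - c'" for a b c c'
  proof -
    have "setdist D D0 \<le> norm (a - b)"
      using setdist_le_dist[OF v(1,2)] by (simp add: dist_norm)
    also have "\<dots> \<le> diameter D"
      using diameter_bounded_bound[OF assms(1) v(3,4)] v(5) by (simp add: dist_norm)
    finally show False using assms(2) by simp
  qed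
  then show ?thesis
    by (auto simp: set_diff_minkowski_def)
qed

lemma cross_corr_support:
  assumes "cross_corr g h x \<noteq> 0"
    and "lat ` {x. g x \<noteq> 0} \<subseteq> A" and "lat ` {x. h x \<noteq> 0} \<subseteq> B"
  shows "lat x \<in> set_diff_minkowski A B"
proof -
  obtain y where y: "h y \<noteq> 0" "g (x + y) \<noteq> 0"
    using assms(1) by (rule cross_corr_nonzeroE)
  then have "lat (x + y) \<in> A" "lat y \<in> B"
    using assms(2,3) by auto
  moreover have "lat x = lat (x + y) - lat y"
    by (simp add: lat_add)
  ultimately show ?thesis
    unfolding set_diff_minkowski_def by blast
qed

section \<open>Reconstruction\<close>

text \<open>
  Both choices of \<open>u\<close> enter only through their values on \<open>D - D0\<close>, where they are required to be the
  sum of the wanted term \<open>f \<star> f0\<close> and the known term \<open>f0 \<star> f0\<close>.  Outside \<open>D - D0\<close> the indicator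
  loses nothing, because \<open>f \<star> f0\<close> vanishes there.
\<close>

lemma recon_formula:
  fixes D0 D :: "(real ^ 'n) set"
  assumes "bounded D0" and "bounded D"
    and supp0: "lat ` {x. f0 x \<noteq> 0} \<subseteq> D0" and supp: "lat ` {x. f x \<noteq> 0} \<subseteq> D"
    and u: "\<And>x. lat x \<in> set_diff_minkowski D D0 \<Longrightarrow>
      u x = dft_const CARD('n) * (cross_corr f f0 x + cross_corr f0 f0 x)"
    and p: "dft f0 p \<noteq> 0"
  shows "dft f p = inverse (cnj (dft f0 p)) * dft (recon_q D0 D f0 u) p"
proof -
  have "recon_q D0 D f0 u x = dft_const CARD('n) * cross_corr f f0 x" for x
  proof (cases "lat x \<in> set_diff_minkowski D D0")
    case True
    have "(\<Sum>y | lat y \<in> D0. f0 (x + y) * cnj (f0 y)) = cross_corr f0 f0 x"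
      using finite_lattice_points[OF assms(1)] supp0
      by (intro cross_corr_eq_sum[symmetric]) auto
    then show ?thesis
      using True unfolding recon_q_def dft_const_def[symmetric] by (simp add: u algebra_simps)
  next
    case False
    then have "cross_corr f f0 x = 0"
      using cross_corr_support[OF _ supp supp0] by blast
    then show ?thesis
      using False by (simp add: recon_q_def)
  qed
  then have "recon_q D0 D f0 u = (\<lambda>x. dft_const CARD('n) * cross_corr f f0 x)"
    by auto
  then have "dft (recon_q D0 D f0 u) p = dft f p * cnj (dft f0 p)"
    by (simp only: dft_cross_corr[OF finite_lattice_support[OF assms(2) supp]
          finite_lattice_support[OF assms(1) supp0]])
  then show ?thesis
    using p by simp
qed

theorem theorem2p10:
  fixes D0 D :: "(real ^ 'n) set"
    and f0 f :: "int ^ 'n \<Rightarrow> complex"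
  assumes "open D0" and "convex D0" and "bounded D0"
    and "open D" and "convex D" and "bounded D"
    and "D0 \<inter> range lat \<noteq> {}" and "D \<inter> range lat \<noteq> {}"
    and "lat ` {x. f0 x \<noteq> 0} \<subseteq> D0" and "lat ` {x. f x \<noteq> 0} \<subseteq> D"
    and "f0 \<noteq> (\<lambda>x. 0)"
  shows "(setdist D D0 > diameter D \<longrightarrow>
           (let u = inv_dft (\<lambda>k. of_real ((cmod (dft (\<lambda>x. f x + f0 x) k))\<^sup>2))
            in \<forall>p. dft f0 p \<noteq> 0 \<longrightarrow>
                 dft f p = inverse (cnj (dft f0 p)) * dft (recon_q D0 D f0 u) p))
       \<and> (setdist D D0 > 0 \<longrightarrow>
           (let u = (\<lambda>x. inv_dft (\<lambda>k. of_real ((cmod (dft (\<lambda>x. f x + f0 x) k))\<^sup>2)) x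
                       - inv_dft (\<lambda>k. of_real ((cmod (dft f k))\<^sup>2)) x)
            in \<forall>p. dft f0 p \<noteq> 0 \<longrightarrow>
                 dft f p = inverse (cnj (dft f0 p)) * dft (recon_q D0 D f0 u) p))"
proof -
  note supp0 = assms(9) and supp = assms(10)
  have fin0: "finite {x. f0 x \<noteq> 0}"
    by (rule finite_lattice_support[OF assms(3) supp0])
  have fin: "finite {x. f x \<noteq> 0}"
    by (rule finite_lattice_support[OF assms(6) supp])
  have finsum: "finite {x. f x + f0 x \<noteq> 0}"
    by (rule finite_subset[of _ "{x. f x \<noteq> 0} \<union> {x. f0 x \<noteq> 0}"]) (use fin fin0 in auto)
  have power_f: "inv_dft (\<lambda>k. of_real ((cmod (dft f k))\<^sup>2)) x
      = dft_const CARD('n) * cross_corr f f x" for x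
    by (rule inv_dft_power_spectrum[OF fin])
  have power_sum: "inv_dft (\<lambda>k. of_real ((cmod (dft (\<lambda>x. f x + f0 x) k))\<^sup>2)) x
      = dft_const CARD('n) *
          (cross_corr f f x + cross_corr f f0 x + cross_corr f0 f x + cross_corr f0 f0 x)" for x
    by (simp only: inv_dft_power_spectrum[OF finsum] cross_corr_add_self[OF fin fin0])
  have mirror: "cross_corr f0 f x = 0"
    if "setdist D D0 > 0" "lat x \<in> set_diff_minkowski D D0" for x
    using disjoint_minkowski_differences[OF assms(5,2) that(1)] that(2)
      cross_corr_support[OF _ supp0 supp] by blast
  have auto_f: "cross_corr f f x = 0"
    if "setdist D D0 > diameter D" "lat x \<in> set_diff_minkowski D D0" for x
    using minkowski_difference_disjoint_self[OF assms(6) that(1)] that(2)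
      cross_corr_support[OF _ supp supp] by blast
  have pos: "setdist D D0 > 0" if "setdist D D0 > diameter D"
    using that diameter_ge_0[OF assms(6)] by simp
  show ?thesis
    unfolding Let_def
  proof (intro conjI impI allI)
    fix p
    assume "setdist D D0 > diameter D" and "dft f0 p \<noteq> 0"
    then show "dft f p = inverse (cnj (dft f0 p)) * dft (recon_q D0 D f0
        (inv_dft (\<lambda>k. of_real ((cmod (dft (\<lambda>x. f x + f0 x) k))\<^sup>2)))) p"
      using assms(3,6) supp supp0 pos
      by (intro recon_formula) (auto simp only: power_sum mirror auto_f add_0_left add_0_right)
  next
    fix p
    assume "setdist D D0 > 0" and "dft f0 p \<noteq> 0"
    then show "dft f p = inverse (cnj (dft f0 p)) * dft (recon_q D0 D f0
        (\<lambda>x. inv_dft (\<lambda>k. of_real ((cmod (dft (\<lambda>x. f x + f0 x) k))\<^sup>2)) x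
           - inv_dft (\<lambda>k. of_real ((cmod (dft f k))\<^sup>2)) x)) p"
      using assms(3,6) supp supp0
      by (intro recon_formula) (auto simp: power_sum power_f mirror algebra_simps simp del: of_real_power)
  qed
qed

end
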